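(* Let $\lambda,\mu>0$, $\alpha=\sqrt{\mu/\lambda}$, and $b_k=\frac{1}{k+1}+k\alpha^2$ for $k\ge 0$. Let the numbers $S^{(k)}_i$ be determined by $$\begin{cases} S^{(1)}_i=S^{(0)}_{i+1}+b_0S^{(0)}_i, & \forall i\ge 0,\\[2pt] S^{(k+1)}_i=S^{(k)}_{i+1}+b_kS^{(k)}_i-\alpha^2S^{(k-1)}_i, & \forall i\ge 0,\ 0\le k\le i+1,\end{cases}$$ with $S^{(-1)}_i=0$ for all $i\ge 0$, $S^{(n)}_i=0$ for all $n>i$, and $S^{(0)}_0=1$. Then for all $k\ge 0$ the series $$p(k,t)=\frac{1}{\alpha^{2k}\,k!}\sum_{i=0}^{+\infty}\frac{(\lambda t)^i}{i!}\,S^{(k)}_i,\qquad t\ge 0,$$ is (convergent and) the solution of the system $$p'(k,t)=-\left(\frac{\lambda}{1+k}+k\mu\right)p(k,t)+1_{\{k\ge 1\}}\frac{\lambda}{k}\,p(k-1,t)+\mu(k+1)\,p(k+1,t),\qquad k\in\mathbb{N}_0,$$ with initial conditions $p(k,0)=\delta_{k,0}$.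
   Context: $\mathbb{N}_0=\{0,1,2,\dots\}$; the prime denotes the derivative with respect to $t$; $\delta_{k,0}$ is the Kronecker delta; the term containing $1_{\{k\ge1\}}$ is absent when $k=0$. The system is the forward equation of the birth and death process $\{X(t)\}_{t\ge 0}$ on $\mathbb{N}_0$ started at $0$, with birth rates $\lambda/(1+k)$ and death rates $k\mu$ in state $k$, and $p(k,t)=P(X(t)=k)$. *)

theory Defs
  imports Complex_Main
begin

definition b_coeff :: "real \<Rightarrow> nat \<Rightarrow> real" where
  "b_coeff \<alpha> k = 1 / (real k + 1) + real k * \<alpha>\<^sup>2"

(* S k i is the number with superscript k and subscript i.  The superscript -1, for which the
   numbers are zero by convention, is only reached from k = 0; it is the "if" below. *)
definition S_system :: "real \<Rightarrow> (nat \<Rightarrow> nat \<Rightarrow> real) \<Rightarrow> bool" where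
  "S_system \<alpha> S \<longleftrightarrow>
     (\<forall>i. S 1 i = S 0 (i + 1) + b_coeff \<alpha> 0 * S 0 i) \<and>
     (\<forall>i k. k \<le> i + 1 \<longrightarrow>
        S (k + 1) i = S k (i + 1) + b_coeff \<alpha> k * S k i
                      - \<alpha>\<^sup>2 * (if k = 0 then 0 else S (k - 1) i)) \<and>
     (\<forall>n i. n > i \<longrightarrow> S n i = 0) \<and>
     S 0 0 = 1"

definition p_series :: "real \<Rightarrow> real \<Rightarrow> (nat \<Rightarrow> nat \<Rightarrow> real) \<Rightarrow> nat \<Rightarrow> real \<Rightarrow> real" where
  "p_series lam \<alpha> S k t =
     1 / (\<alpha> ^ (2 * k) * fact k) * (\<Sum>i. (lam * t) ^ i / fact i * S k i)"

(* Time ranges over [0, \<infinity>), so the derivative at t = 0 is the right derivative. *)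
definition forward_system :: "real \<Rightarrow> real \<Rightarrow> (nat \<Rightarrow> real \<Rightarrow> real) \<Rightarrow> bool" where
  "forward_system lam \<mu> q \<longleftrightarrow>
     (\<forall>k. \<forall>t\<ge>0. (q k has_real_derivative
          (- (lam / (1 + real k) + real k * \<mu>) * q k t
           + (if k \<ge> 1 then lam / real k * q (k - 1) t else 0)
           + \<mu> * (real k + 1) * q (k + 1) t)) (at t within {0..}))"

definition starts_at_0 :: "(nat \<Rightarrow> real \<Rightarrow> real) \<Rightarrow> bool" where
  "starts_at_0 q \<longleftrightarrow> (\<forall>k. q k 0 = (if k = 0 then 1 else 0))"

definition state_probabilities :: "(nat \<Rightarrow> real \<Rightarrow> real) \<Rightarrow> bool" where
  "state_probabilities q \<longleftrightarrow> (\<forall>t\<ge>0. (\<forall>k. 0 \<le> q k t) \<and> (\<lambda>k. q k t) sums 1)"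

(* An infinite system with q 0 left free has many solutions: a smooth q 0 that is flat at t = 0
   determines all the other components.  "The" solution is the one formed by the state
   probabilities of a process on the natural numbers, and uniqueness is meant in that class. *)
definition is_the_solution :: "real \<Rightarrow> real \<Rightarrow> (nat \<Rightarrow> real \<Rightarrow> real) \<Rightarrow> bool" where
  "is_the_solution lam \<mu> p \<longleftrightarrow>
     forward_system lam \<mu> p \<and> starts_at_0 p \<and> state_probabilities p \<and>
     (\<forall>q. forward_system lam \<mu> q \<and> starts_at_0 q \<and> state_probabilities q \<longrightarrow>
          (\<forall>k. \<forall>t\<ge>0. q k t = p k t))"

(* The defining conditions do determine the numbers: they amount to a recursion on i. *)
primrec S_rec :: "real \<Rightarrow> nat \<Rightarrow> nat \<Rightarrow> real" where
  "S_rec \<alpha> 0 = (\<lambda>k. if k = 0 then 1 else 0)"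
| "S_rec \<alpha> (Suc i) = (\<lambda>k. if k > Suc i then 0 else
     S_rec \<alpha> i (k + 1) - b_coeff \<alpha> k * S_rec \<alpha> i k
     + \<alpha>\<^sup>2 * (if k = 0 then 0 else S_rec \<alpha> i (k - 1)))"

lemma S_rec_0: "k > i \<Longrightarrow> S_rec \<alpha> i k = 0"
  by (cases i) auto

lemma S_system_ex1: "\<exists>!S. S_system \<alpha> S"
proof
  show "S_system \<alpha> (\<lambda>k i. S_rec \<alpha> i k)"
    unfolding S_system_def by (auto simp: S_rec_0)
next
  fix S assume S: "S_system \<alpha> S"
  have "S k i = S_rec \<alpha> i k" for k i
  proof (induction i arbitrary: k)
    case 0
    then show ?case using S by (auto simp: S_system_def)
  next
    case (Suc i)
    show ?case
    proof (cases "k > Suc i")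
      case True
      then show ?thesis using S by (auto simp: S_system_def)
    next
      case False
      then have "S (k + 1) i = S k (i + 1) + b_coeff \<alpha> k * S k i
                 - \<alpha>\<^sup>2 * (if k = 0 then 0 else S (k - 1) i)"
        using S unfolding S_system_def by simp
      then show ?thesis using False by (simp add: Suc.IH)
    qed
  qed
  then show "S = (\<lambda>k i. S_rec \<alpha> i k)" by blast
qed

end

theory Submission
  imports Defs "HOL-Analysis.Derivative"
begin

text \<open>An explicit entire majorant shows that the power series converge for all times and that
  \<open>p(k,t)\<close> decays like \<open>C\<^sup>k / (k!)\<^sup>2\<close>, uniformly for bounded \<open>t\<close>; termwise differentiation turns the
  recursion into the forward equation. The derivative of \<open>p(0,t) + \<dots> + p(n,t)\<close> telescopes to boundary
  terms that vanish as \<open>n\<close> grows, so the total mass stays \<open>1\<close>. A minimum principle, valid for solutions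
  that tend to \<open>0\<close> uniformly as \<open>k\<close> grows, gives nonnegativity, and applied to differences it gives
  uniqueness.\<close>

section \<open>The recursion and an entire majorant for it\<close>

text \<open>For \<open>k > i + 1\<close> every term vanishes, \<open>S (k - 1) i\<close> included
  because \<open>k - 1 > i\<close>. So the recursion, solved for the next subscript, holds for all
  \<open>k\<close>, as termwise differentiation requires.\<close>

lemma S_system_Suc:
  assumes "S_system \<alpha> S"
  shows "S k (Suc i) = S (Suc k) i - b_coeff \<alpha> k * S k i
           + \<alpha>\<^sup>2 * (if k = 0 then 0 else S (k - 1) i)"
proof (cases "k \<le> i + 1")
  case True
  then have "S (k + 1) i = S k (i + 1) + b_coeff \<alpha> k * S k i
               - \<alpha>\<^sup>2 * (if k = 0 then 0 else S (k - 1) i)"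
    using assms unfolding S_system_def by blast
  then show ?thesis by simp
next
  case False
  then show ?thesis using assms unfolding S_system_def by auto
qed

lemma S_system_0: "S_system \<alpha> S \<Longrightarrow> S k 0 = (if k = 0 then 1 else 0)"
  by (auto simp: S_system_def)

text \<open>This is the coefficient of \<open>z^k\<close> in
  \<open>G = exp ((exp (a s) - 1) (z + 1/a))\<close>, which equals 1 at \<open>s = 0\<close> and
  satisfies \<open>G_s = (1 + a z) (G_z + G)\<close>.\<close>

definition majorant :: "real \<Rightarrow> nat \<Rightarrow> real \<Rightarrow> real" where
  "majorant a k s = exp ((exp (a * s) - 1) / a) * (exp (a * s) - 1) ^ k / fact k"

lemma majorant_nonneg: "a > 0 \<Longrightarrow> s \<ge> 0 \<Longrightarrow> 0 \<le> majorant a k s"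
  by (auto simp: majorant_def intro!: mult_nonneg_nonneg divide_nonneg_nonneg)

lemma majorant_mono: "a > 0 \<Longrightarrow> 0 \<le> s \<Longrightarrow> s \<le> s' \<Longrightarrow> majorant a k s \<le> majorant a k s'"
  unfolding majorant_def
  by (intro divide_right_mono mult_mono power_mono) (auto intro!: divide_right_mono)

text \<open>With \<open>E = exp (a s)\<close>, the derivative of each factor carries a factor
  \<open>E\<close>. Writing \<open>E = (E - 1) + 1\<close> splits each product into adjacent powers
  of \<open>E - 1\<close>, that is, into the terms for \<open>k + 1\<close>, \<open>k\<close> and
  \<open>k - 1\<close>.\<close>

lemma majorant_deriv:
  assumes "a > 0"
  shows "(majorant a k has_real_derivative
            real (Suc k) * majorant a (Suc k) s + (1 + real k * a) * majorant a k s
            + a * (if k = 0 then 0 else majorant a (k - 1) s)) (at s)"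
proof (cases k)
  case 0
  show ?thesis using assms unfolding 0 majorant_def
    by (auto intro!: derivative_eq_intros simp: field_simps)
next
  case (Suc j)
  define E where "E = exp (a * s)"
  define X where "X = exp ((E - 1) / a)"
  have f: "fact (Suc j) = (real j + 1) * fact j" "fact (Suc (Suc j)) = (real j + 2) * ((real j + 1) * fact j)"
    by (simp_all add: algebra_simps)
  have nz: "real j + 1 \<noteq> 0" "real j + 2 \<noteq> 0" "(fact j :: real) \<noteq> 0" by (simp_all add: add_eq_0_iff)
  have "(majorant a (Suc j) has_real_derivative
          (X * E * (E - 1) ^ Suc j + X * (real (Suc j) * (E - 1) ^ j * (a * E))) / fact (Suc j)) (at s)"
  proof -
    have E: "((\<lambda>s. exp (a * s) - 1) has_real_derivative a * E) (at s)"
      unfolding E_def by (auto intro!: derivative_eq_intros)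
    have X: "((\<lambda>s. exp ((exp (a * s) - 1) / a)) has_real_derivative X * E) (at s)"
      unfolding E_def X_def using assms by (auto intro!: derivative_eq_intros)
    show ?thesis
      unfolding majorant_def[abs_def]
      by (rule DERIV_cong[OF DERIV_cdivide[OF DERIV_mult[OF X DERIV_power[OF E]]]])
        (simp add: E_def X_def mult_ac)
  qed
  moreover have "(X * E * (E - 1) ^ Suc j + X * (real (Suc j) * (E - 1) ^ j * (a * E))) / fact (Suc j)
      = real (Suc (Suc j)) * majorant a (Suc (Suc j)) s + (1 + real (Suc j) * a) * majorant a (Suc j) s
            + a * majorant a j s"
    unfolding majorant_def E_def[symmetric] X_def[symmetric] f
    using nz by (simp add: divide_simps) (simp add: algebra_simps)
  ultimately show ?thesis using Suc by simp
qed

lemma b_coeff_bounds: "0 \<le> b_coeff \<alpha> k" "b_coeff \<alpha> k \<le> 1 + real k * \<alpha>\<^sup>2"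
  by (auto simp: b_coeff_def)

text \<open>The coefficients \<open>b\<^sub>k\<close> grow linearly, so bounding the recursion crudely gives \<open>S\<^sub>i\<close> of
  order \<open>i!\<close> and only a finite radius of convergence. If all signs are made positive, \<open>b\<^sub>k\<close> is
  enlarged to \<open>1 + k \<alpha>\<^sup>2\<close> and \<open>S (k + 1)\<close> is weighted by \<open>k + 1\<close>, as for the queue with infinitely many
  servers, then \<^const>\<open>majorant\<close> solves the resulting system exactly, and it is finite for all times.\<close>

lemma S_partial_sum_le_majorant:
  assumes "S_system \<alpha> S" "\<alpha> \<noteq> 0" "s \<ge> 0"
  shows "(\<Sum>i<n. \<bar>S k i\<bar> / fact i * s ^ i) \<le> majorant (\<alpha>\<^sup>2) k s"
  using \<open>s \<ge> 0\<close>
proof (induction n arbitrary: k s)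
  case 0
  then show ?case using majorant_nonneg[of "\<alpha>\<^sup>2"] assms by simp
next
  case (Suc n)
  let ?a = "\<alpha>\<^sup>2"
  let ?P = "\<lambda>k x. (\<Sum>i<n. \<bar>S k i\<bar> / fact i * x ^ i)"
  have a: "?a > 0" using assms by simp
  \<comment> \<open>Differentiating the sum of \<open>Suc n\<close> terms leaves \<open>n\<close>
    terms with shifted subscript, which the recursion bounds by sums of length \<open>n\<close> at
    \<open>k\<close> and its neighbours. The induction hypothesis, general in \<open>k\<close> and
    \<open>s\<close>, then makes the derivative of \<open>g\<close> nonnegative, and
    \<open>g 0 = 0\<close>.\<close>
  define g where "g x = majorant ?a k x - (\<Sum>i<Suc n. \<bar>S k i\<bar> / fact i * x ^ i)" for x
  have "g 0 \<le> g s"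
  proof (rule DERIV_nonneg_imp_nondecreasing[OF Suc.prems])
    fix x :: real assume x: "0 \<le> x" "x \<le> s"
    let ?D = "real (Suc k) * majorant ?a (Suc k) x + (1 + real k * ?a) * majorant ?a k x
            + ?a * (if k = 0 then 0 else majorant ?a (k - 1) x)"
    have t: "((\<lambda>x. \<bar>S k (Suc i)\<bar> / fact (Suc i) * x ^ Suc i) has_real_derivative
           \<bar>S k (Suc i)\<bar> / fact i * x ^ i) (at x)" for i
    proof -
      have "\<bar>S k (Suc i)\<bar> / fact (Suc i) * (real (Suc i) * x ^ i) = \<bar>S k (Suc i)\<bar> / fact i * x ^ i"
        by (simp add: divide_simps del: of_nat_Suc)
      with DERIV_cmult[OF DERIV_pow[of "Suc i" x], of "\<bar>S k (Suc i)\<bar> / fact (Suc i)"]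
      show ?thesis by simp
    qed
    have "((\<lambda>x. \<Sum>i<Suc n. \<bar>S k i\<bar> / fact i * x ^ i) has_real_derivative
              (\<Sum>i<n. \<bar>S k (Suc i)\<bar> / fact i * x ^ i)) (at x)"
      unfolding sum.lessThan_Suc_shift
      using DERIV_add[OF DERIV_const DERIV_sum[OF t], of "\<bar>S k 0\<bar>" _ "{..<n}"] by simp
    then have "(g has_real_derivative ?D - (\<Sum>i<n. \<bar>S k (Suc i)\<bar> / fact i * x ^ i)) (at x)"
      unfolding g_def[abs_def] by (intro DERIV_diff majorant_deriv[OF a])
    moreover have "(\<Sum>i<n. \<bar>S k (Suc i)\<bar> / fact i * x ^ i) \<le> ?D"
    proof -
      have "(\<Sum>i<n. \<bar>S k (Suc i)\<bar> / fact i * x ^ i)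
         \<le> (\<Sum>i<n. (\<bar>S (Suc k) i\<bar> + b_coeff \<alpha> k * \<bar>S k i\<bar>
              + ?a * (if k = 0 then 0 else \<bar>S (k - 1) i\<bar>)) / fact i * x ^ i)"
      proof (intro sum_mono mult_right_mono divide_right_mono)
        fix i
        have "\<bar>b_coeff \<alpha> k * S k i\<bar> = b_coeff \<alpha> k * \<bar>S k i\<bar>"
          by (simp add: abs_mult b_coeff_bounds)
        moreover have "\<bar>?a * (if k = 0 then 0 else S (k - 1) i)\<bar>
            = ?a * (if k = 0 then 0 else \<bar>S (k - 1) i\<bar>)"
          by (simp add: abs_mult)
        ultimately show "\<bar>S k (Suc i)\<bar> \<le> \<bar>S (Suc k) i\<bar> + b_coeff \<alpha> k * \<bar>S k i\<bar>
              + ?a * (if k = 0 then 0 else \<bar>S (k - 1) i\<bar>)"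
          unfolding S_system_Suc[OF assms(1)] by linarith
      qed (use x in auto)
      also have "\<dots> = ?P (Suc k) x + b_coeff \<alpha> k * ?P k x + ?a * (if k = 0 then 0 else ?P (k - 1) x)"
        by (simp add: sum.distrib sum_distrib_left algebra_simps add_divide_distrib)
      also have "\<dots> \<le> real (Suc k) * majorant ?a (Suc k) x + (1 + real k * ?a) * majorant ?a k x
            + ?a * (if k = 0 then 0 else majorant ?a (k - 1) x)"
      proof (intro add_mono)
        have "?P (Suc k) x \<le> 1 * majorant ?a (Suc k) x" using Suc.IH x by simp
        also have "\<dots> \<le> real (Suc k) * majorant ?a (Suc k) x"
          by (intro mult_right_mono majorant_nonneg a x) simp
        finally show "?P (Suc k) x \<le> real (Suc k) * majorant ?a (Suc k) x" .
        show "b_coeff \<alpha> k * ?P k x \<le> (1 + real k * ?a) * majorant ?a k x"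
          using x by (intro mult_mono b_coeff_bounds Suc.IH) (auto intro!: sum_nonneg)
        show "?a * (if k = 0 then 0 else ?P (k - 1) x) \<le> ?a * (if k = 0 then 0 else majorant ?a (k - 1) x)"
          using Suc.IH x by (intro mult_left_mono) auto
      qed
      finally show ?thesis .
    qed
    ultimately show "\<exists>y. (g has_real_derivative y) (at x) \<and> y \<ge> 0" by force
  qed
  moreover have "g 0 = 0"
    unfolding g_def sum.lessThan_Suc_shift
    by (simp add: majorant_def S_system_0[OF assms(1)] power_0_left)
  ultimately show ?case by (simp add: g_def)
qed

section \<open>Convergence and termwise differentiation\<close>

lemma S_series_abs:
  assumes "S_system \<alpha> S" "\<alpha> \<noteq> 0"
  shows "summable (\<lambda>i. \<bar>S k i / fact i * x ^ i\<bar>)"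
    and "(\<Sum>i. \<bar>S k i / fact i * x ^ i\<bar>) \<le> majorant (\<alpha>\<^sup>2) k \<bar>x\<bar>"
proof -
  have b: "(\<Sum>i<n. \<bar>S k i / fact i * x ^ i\<bar>) \<le> majorant (\<alpha>\<^sup>2) k \<bar>x\<bar>" for n
    using S_partial_sum_le_majorant[OF assms, of "\<bar>x\<bar>" k n] by (simp add: abs_mult power_abs)
  show s: "summable (\<lambda>i. \<bar>S k i / fact i * x ^ i\<bar>)"
    by (rule summableI_nonneg_bounded[OF _ b]) simp
  show "(\<Sum>i. \<bar>S k i / fact i * x ^ i\<bar>) \<le> majorant (\<alpha>\<^sup>2) k \<bar>x\<bar>"
    by (rule suminf_le_const[OF s b])
qed

lemma S_series_summable:
  assumes "S_system \<alpha> S" "\<alpha> \<noteq> 0"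
  shows "summable (\<lambda>i. S k i / fact i * x ^ i)"
  by (rule summable_rabs_cancel[OF S_series_abs(1)[OF assms]])

text \<open>Because of the factor \<open>1 / fact i\<close>, differentiation is the shift from
  \<open>i\<close> to \<open>i + 1\<close>, and the recursion rewrites the shifted coefficients at
  subscript \<open>i\<close>.\<close>

lemma S_series_deriv:
  assumes "S_system \<alpha> S" "\<alpha> \<noteq> 0"
  defines "F \<equiv> \<lambda>k x. \<Sum>i. S k i / fact i * x ^ i"
  shows "(F k has_real_derivative
            F (Suc k) x - b_coeff \<alpha> k * F k x + \<alpha>\<^sup>2 * (if k = 0 then 0 else F (k - 1) x)) (at x)"
proof -
  note sm = S_series_summable[OF assms(1,2)]
  have "diffs (\<lambda>i. S k i / fact i) = (\<lambda>i. S k (Suc i) / fact i)"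
    by (auto simp: diffs_def fun_eq_iff divide_simps simp del: of_nat_Suc)
  then have "(F k has_real_derivative (\<Sum>i. S k (Suc i) / fact i * x ^ i)) (at x)"
    using termdiffs_strong_converges_everywhere[OF sm, of k x] unfolding F_def by simp
  moreover have "(\<lambda>i. S k (Suc i) / fact i * x ^ i) sums
      (F (Suc k) x - b_coeff \<alpha> k * F k x + \<alpha>\<^sup>2 * (if k = 0 then 0 else F (k - 1) x))"
  proof -
    have e: "S k (Suc i) / fact i * x ^ i
        = S (Suc k) i / fact i * x ^ i - b_coeff \<alpha> k * (S k i / fact i * x ^ i)
          + \<alpha>\<^sup>2 * (if k = 0 then 0 else S (k - 1) i / fact i * x ^ i)" for i
      unfolding S_system_Suc[OF assms(1)] by (simp add: field_simps)
    have F: "(\<lambda>i. S j i / fact i * x ^ i) sums F j x" for j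
      using sm[THEN summable_sums] by (simp add: F_def)
    then have "(\<lambda>i. if k = 0 then 0 else S (k - 1) i / fact i * x ^ i) sums
        (if k = 0 then 0 else F (k - 1) x)" by simp
    then show ?thesis unfolding e by (intro sums_add sums_diff sums_mult F)
  qed
  ultimately show ?thesis by (simp add: sums_iff)
qed

lemma p_series_eq:
  "p_series lam \<alpha> S k t = 1 / (\<alpha> ^ (2 * k) * fact k) * (\<Sum>i. S k i / fact i * (lam * t) ^ i)"
  by (simp add: p_series_def mult.commute)

text \<open>The normalising constants turn the coefficients of the recursion into rates:
  \<open>c k = \<alpha>^2 (k + 1) c (k + 1)\<close> produces the death rate,
  \<open>\<alpha>^2 c k = c (k - 1) / k\<close> the birth rate, and
  \<open>lam * b_coeff \<alpha> k\<close> is the total exit rate.\<close>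

lemma p_series_forward:
  assumes "lam > 0" "\<mu> = lam * \<alpha>\<^sup>2" "\<alpha> \<noteq> 0" "S_system \<alpha> S"
  shows "forward_system lam \<mu> (p_series lam \<alpha> S)"
  unfolding forward_system_def
\<comment> \<open>The series converge for negative \<open>t\<close> too, so a two-sided derivative
  is established and then restricted.\<close>
proof (intro allI impI, rule has_field_derivative_at_within)
  fix k :: nat and t :: real
  define F where "F k x = (\<Sum>i. S k i / fact i * x ^ i)" for k x
  define c where "c k = 1 / ((\<alpha>\<^sup>2) ^ k * fact k)" for k
  have p: "p_series lam \<alpha> S = (\<lambda>k t. c k * F k (lam * t))"
    by (intro ext) (simp only: p_series_eq F_def c_def power_mult)
  have "((\<lambda>t. F k (lam * t)) has_real_derivative
         (F (Suc k) (lam * t) - b_coeff \<alpha> k * F k (lam * t)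
          + \<alpha>\<^sup>2 * (if k = 0 then 0 else F (k - 1) (lam * t))) * lam) (at t)"
    using S_series_deriv[OF assms(4,3), of k "lam * t", folded F_def]
    by (intro DERIV_chain2[of "F k"]) (auto intro!: derivative_eq_intros)
  from DERIV_cmult[OF this, of "c k"]
  have D: "(p_series lam \<alpha> S k has_real_derivative
         c k * ((F (Suc k) (lam * t) - b_coeff \<alpha> k * F k (lam * t)
          + \<alpha>\<^sup>2 * (if k = 0 then 0 else F (k - 1) (lam * t))) * lam)) (at t)"
    by (simp add: p)
  have c1: "c k = \<alpha>\<^sup>2 * (real k + 1) * c (Suc k)"
    using assms(3) by (simp add: c_def divide_simps)
  have c2: "\<alpha>\<^sup>2 * c k = c (k - 1) / real k" if "k \<ge> 1"
    using that assms(3) by (cases k) (auto simp: c_def divide_simps)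
  have "c k * ((F (Suc k) (lam * t) - b_coeff \<alpha> k * F k (lam * t)
          + \<alpha>\<^sup>2 * (if k = 0 then 0 else F (k - 1) (lam * t))) * lam)
      = lam * c k * F (Suc k) (lam * t) - lam * b_coeff \<alpha> k * (c k * F k (lam * t))
        + lam * (if k = 0 then 0 else \<alpha>\<^sup>2 * c k * F (k - 1) (lam * t))"
    by (simp add: algebra_simps)
  also have "\<dots> = - (lam / (1 + real k) + real k * \<mu>) * (c k * F k (lam * t))
         + (if k \<ge> 1 then lam / real k * (c (k - 1) * F (k - 1) (lam * t)) else 0)
         + \<mu> * (real k + 1) * (c (k + 1) * F (k + 1) (lam * t))"
  proof -
    have 1: "lam * c k * F (Suc k) (lam * t) = \<mu> * (real k + 1) * (c (k + 1) * F (k + 1) (lam * t))"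
      by (subst c1) (simp add: assms(2))
    have 2: "lam * b_coeff \<alpha> k = lam / (1 + real k) + real k * \<mu>"
      by (simp add: b_coeff_def assms(2) distrib_left add.commute)
    have 3: "lam * (if k = 0 then 0 else \<alpha>\<^sup>2 * c k * F (k - 1) (lam * t))
        = (if k \<ge> 1 then lam / real k * (c (k - 1) * F (k - 1) (lam * t)) else 0)"
      using c2 by auto
    show ?thesis unfolding 1 2 3 mult_minus_left by simp
  qed
  finally show "(p_series lam \<alpha> S k has_real_derivative
          (- (lam / (1 + real k) + real k * \<mu>) * p_series lam \<alpha> S k t
           + (if k \<ge> 1 then lam / real k * p_series lam \<alpha> S (k - 1) t else 0)
           + \<mu> * (real k + 1) * p_series lam \<alpha> S (k + 1) t)) (at t)"
    unfolding p by (rule DERIV_cong[OF D[unfolded p]])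
qed

lemma p_series_starts_at_0:
  assumes "S_system \<alpha> S"
  shows "starts_at_0 (p_series lam \<alpha> S)"
  unfolding starts_at_0_def p_series_eq
proof
  fix k
  have "(\<Sum>i. S k i / fact i * (lam * 0) ^ i) = S k 0 / fact 0"
    unfolding mult_zero_right by (rule powser_zero)
  then show "1 / (\<alpha> ^ (2 * k) * fact k) * (\<Sum>i. S k i / fact i * (lam * 0) ^ i)
      = (if k = 0 then 1 else 0)"
    by (simp only: S_system_0[OF assms]) simp
qed

section \<open>Decay in k, uniformly on bounded time intervals\<close>

text \<open>One factorial comes from the majorant and one from the normalisation, whose power of
  \<open>\<alpha>\<close> also supplies the denominator of \<open>C ^ k\<close>.\<close>

lemma p_series_bound:
  assumes "lam > 0" "\<alpha> \<noteq> 0" "S_system \<alpha> S" "t \<in> {0..T}"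
  defines "C \<equiv> (exp (\<alpha>\<^sup>2 * (lam * T)) - 1) / \<alpha>\<^sup>2"
  shows "\<bar>p_series lam \<alpha> S k t\<bar> \<le> exp C * C ^ k / (fact k)\<^sup>2"
proof -
  let ?f = "\<lambda>i. S k i / fact i * (lam * t) ^ i"
  have "\<bar>\<Sum>i. ?f i\<bar> \<le> (\<Sum>i. \<bar>?f i\<bar>)"
    by (rule summable_rabs[OF S_series_abs(1)[OF assms(3,2)]])
  also have "\<dots> \<le> majorant (\<alpha>\<^sup>2) k \<bar>lam * t\<bar>"
    by (rule S_series_abs(2)[OF assms(3,2)])
  also have "\<dots> \<le> majorant (\<alpha>\<^sup>2) k (lam * T)"
    using assms by (intro majorant_mono) auto
  finally have "\<bar>p_series lam \<alpha> S k t\<bar> \<le> 1 / (\<alpha> ^ (2 * k) * fact k) * majorant (\<alpha>\<^sup>2) k (lam * T)"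
    unfolding p_series_eq abs_mult by (simp add: power_mult divide_right_mono)
  also have "\<dots> = exp C * C ^ k / (fact k)\<^sup>2"
    by (simp add: majorant_def C_def power_mult power_divide power2_eq_square)
  finally show ?thesis .
qed

lemma uniform_limit_zeroI:
  fixes q :: "nat \<Rightarrow> 'a \<Rightarrow> real"
  assumes "\<And>k t. t \<in> A \<Longrightarrow> \<bar>q k t\<bar> \<le> B k" "B \<longlonglongrightarrow> 0"
  shows "uniform_limit A q (\<lambda>_. 0) sequentially"
proof (rule uniform_limitI)
  fix e :: real assume "e > 0"
  then have "\<forall>\<^sub>F k in sequentially. B k < e" using assms(2) by (rule order_tendstoD(2)[rotated])
  then show "\<forall>\<^sub>F k in sequentially. \<forall>t\<in>A. dist (q k t) 0 < e"
    by eventually_elim (use assms(1) in \<open>auto intro: le_less_trans\<close>)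
qed

lemma power_div_fact_tendsto_0: "(\<lambda>k. (C::real) ^ k / fact k) \<longlonglongrightarrow> 0"
  using summable_LIMSEQ_zero[OF summable_exp[of C]]
  by (simp add: divide_inverse mult.commute)

text \<open>One of the two factorials suffices for decay; the other absorbs the weight
  \<open>Suc k\<close>. The weighted limit controls the death flux from state \<open>k + 1\<close>
  to \<open>k\<close>.\<close>

lemma p_series_uniform_limit:
  assumes "lam > 0" "\<alpha> \<noteq> 0" "S_system \<alpha> S"
  shows "uniform_limit {0..T} (p_series lam \<alpha> S) (\<lambda>_. 0) sequentially"
    and "uniform_limit {0..T} (\<lambda>k t. real (Suc k) * p_series lam \<alpha> S (Suc k) t) (\<lambda>_. 0) sequentially"
proof -
  define C where "C = (exp (\<alpha>\<^sup>2 * (lam * T)) - 1) / \<alpha>\<^sup>2"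
  note b = p_series_bound[OF assms, of _ T, folded C_def]
  \<comment> \<open>For \<open>T < 0\<close> the constant is negative, but then the interval is
    empty; a point \<open>t\<close> in it forces \<open>T\<close> to be nonnegative.\<close>
  have C: "C \<ge> 0" if "t \<in> {0..T}" for t using that assms by (auto simp: C_def)
  have 1: "\<bar>p_series lam \<alpha> S k t\<bar> \<le> exp C * (C ^ k / fact k)" if t: "t \<in> {0..T}" for k t
  proof -
    have "exp C * C ^ k / (fact k)\<^sup>2 \<le> exp C * C ^ k / fact k"
      using C[OF t] by (intro divide_left_mono) (auto simp: power2_eq_square fact_ge_1)
    with b[OF t, of k] show ?thesis by simp
  qed
  have 2: "\<bar>real (Suc k) * p_series lam \<alpha> S (Suc k) t\<bar> \<le> exp C * C * (C ^ k / fact k)"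
    if t: "t \<in> {0..T}" for k t
  proof -
    have "\<bar>real (Suc k) * p_series lam \<alpha> S (Suc k) t\<bar>
        \<le> real (Suc k) * (exp C * C ^ Suc k / (fact (Suc k))\<^sup>2)"
      unfolding abs_mult abs_of_nat by (intro mult_left_mono b t) simp
    also have "\<dots> = exp C * C ^ Suc k / (real (Suc k) * (fact k * fact k))"
      by (simp add: power2_eq_square divide_simps)
    also have "\<dots> \<le> exp C * C ^ Suc k / fact k"
    proof (rule divide_left_mono)
      have "1 \<le> real (Suc k) * fact k" using fact_ge_1[of k] by (simp add: mult_le_one le_add1 mult_ge1_I)
      from mult_right_mono[OF this, of "fact k"]
      show "fact k \<le> real (Suc k) * (fact k * fact k)" by (simp add: mult.assoc)
    qed (use C[OF t] in auto)
    finally show ?thesis by (simp add: mult.assoc)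
  qed
  show "uniform_limit {0..T} (p_series lam \<alpha> S) (\<lambda>_. 0) sequentially"
    by (rule uniform_limit_zeroI[OF 1 tendsto_mult_right_zero[OF power_div_fact_tendsto_0]])
  show "uniform_limit {0..T} (\<lambda>k t. real (Suc k) * p_series lam \<alpha> S (Suc k) t) (\<lambda>_. 0) sequentially"
    by (rule uniform_limit_zeroI[OF 2 tendsto_mult_right_zero[OF power_div_fact_tendsto_0]])
qed

section \<open>General solutions and the minimum principle\<close>

lemma forward_system_continuous:
  assumes "forward_system lam \<mu> q"
  shows "continuous_on {0..T} (q k)"
proof -
  have "continuous (at t within {0..T}) (q k)" if "t \<in> {0..T}" for t
  proof -
    have "\<exists>D. (q k has_real_derivative D) (at t within {0..})"
      using assms that unfolding forward_system_def by auto
    then show ?thesis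
      by (auto intro: DERIV_continuous continuous_within_subset)
  qed
  then show ?thesis by (simp add: continuous_on_eq_continuous_within)
qed

lemma forward_system_diff:
  assumes "forward_system lam \<mu> q" "forward_system lam \<mu> r"
  shows "forward_system lam \<mu> (\<lambda>k t. q k t - r k t)"
  unfolding forward_system_def
proof (intro allI impI)
  fix k :: nat and t :: real assume t: "t \<ge> 0"
  show "((\<lambda>t. q k t - r k t) has_real_derivative
          (- (lam / (1 + real k) + real k * \<mu>) * (q k t - r k t)
           + (if k \<ge> 1 then lam / real k * (q (k - 1) t - r (k - 1) t) else 0)
           + \<mu> * (real k + 1) * (q (k + 1) t - r (k + 1) t))) (at t within {0..})"
    by (rule DERIV_cong[OF DERIV_diff])
      (use assms t in \<open>auto simp: forward_system_def algebra_simps\<close>)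
qed

text \<open>A minimum principle: the constants are supersolutions up to the exponential factor
  \<open>exp ((\<mu> + lam) t)\<close>, and the uniform decay in \<open>k\<close> makes the infimum over
  all states and times a minimum.\<close>

lemma forward_system_nonneg:
  assumes lam: "lam > 0" and mu: "\<mu> > 0" and fw: "forward_system lam \<mu> q"
    and q0: "\<And>k. 0 \<le> q k 0"
    and decay: "\<And>T. uniform_limit {0..T} q (\<lambda>_. 0) sequentially"
    and "t \<ge> 0"
  shows "0 \<le> q k t"
proof (rule ccontr)
  assume neg: "\<not> 0 \<le> q k t"
  \<comment> \<open>On a constant, the right-hand side in state \<open>j\<close> has coefficient
    \<open>\<mu> + lam / j - lam / (1 + j)\<close> (without \<open>lam / j\<close> if
    \<open>j = 0\<close>), at most \<open>\<mu> + lam\<close>. The extra 1 makes the damped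
    coefficient strictly negative.\<close>
  define M where "M = \<mu> + lam + 1"
  define m where "m j x = exp (- M * x) * q j x" for j x
  define c where "c = m k t"
  have c: "c < 0" using neg by (simp add: c_def m_def mult_pos_neg)
  have M: "M > 0" using lam mu by (simp add: M_def)
  have "\<forall>\<^sub>F j in sequentially. \<forall>x\<in>{0..t}. dist (q j x) 0 < - c"
    using uniform_limitD[OF decay] c by simp
  then obtain K where K: "\<And>j x. j \<ge> K \<Longrightarrow> x \<in> {0..t} \<Longrightarrow> \<bar>q j x\<bar> < - c"
    unfolding eventually_sequentially dist_real_def by (metis diff_zero)
  \<comment> \<open>The damping factor is at most 1, so states from \<open>K\<close> on stay
    strictly above \<open>c\<close>. Only finitely many states compete for the minimum, and
    \<open>k\<close> is one of them.\<close>
  have far: "c < m j x" if "j \<ge> K" "x \<in> {0..t}" for j x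
  proof -
    have "\<bar>m j x\<bar> \<le> 1 * \<bar>q j x\<bar>"
      unfolding m_def abs_mult using that M by (intro mult_right_mono) auto
    with K[OF that] show ?thesis by linarith
  qed
  have "k < K" using far[of k t] \<open>t \<ge> 0\<close> by (force simp: c_def)
  have "\<exists>x\<in>{0..t}. \<forall>y\<in>{0..t}. m j x \<le> m j y" for j
    unfolding m_def using \<open>t \<ge> 0\<close>
    by (intro continuous_attains_inf continuous_intros forward_system_continuous[OF fw]) auto
  then obtain tau where tau: "\<And>j. tau j \<in> {0..t}" "\<And>j y. y \<in> {0..t} \<Longrightarrow> m j (tau j) \<le> m j y"
    by metis
  obtain j where j: "j < K" "\<And>i. i < K \<Longrightarrow> m j (tau j) \<le> m i (tau i)"
  proof -
    have "\<exists>j. is_arg_min (\<lambda>j. m j (tau j)) (\<lambda>j. j \<in> {..<K}) j"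
      using \<open>k < K\<close> by (intro ex_is_arg_min_if_finite) auto
    then show ?thesis using that by (auto simp: is_arg_min_linorder)
  qed
  define s where "s = tau j"
  have s: "s \<in> {0..t}" using tau by (simp add: s_def)
  have mc: "m j s \<le> c"
    using j(2)[OF \<open>k < K\<close>] tau(2)[of t k] \<open>t \<ge> 0\<close> by (simp add: s_def c_def)
  have min: "m j s \<le> m i x" if "x \<in> {0..t}" for i x
  proof (cases "i < K")
    case True
    then show ?thesis using j(2)[OF True] tau(2)[OF that, of i] by (simp add: s_def)
  next
    case False
    then show ?thesis using far[of i x] that mc by simp
  qed
  \<comment> \<open>The minimum is negative and the initial values are not, so there is room to the
    left of \<open>s\<close>.\<close>
  have "s \<noteq> 0"
    using q0[of j] mc c by (auto simp: m_def)
  then have "s > 0" using s by simp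
  define R where "R = lam / (1 + real j) + real j * \<mu>"
  define D where "D = - (M + R) * m j s + (if j \<ge> 1 then lam / real j * m (j - 1) s else 0)
           + \<mu> * (real j + 1) * m (j + 1) s"
  have "(q j has_real_derivative
          (- R * q j s
           + (if j \<ge> 1 then lam / real j * q (j - 1) s else 0)
           + \<mu> * (real j + 1) * q (j + 1) s)) (at s within {0..})"
    using fw s unfolding forward_system_def R_def by auto
  then have "(m j has_real_derivative D) (at s within {0..})"
    unfolding m_def[abs_def] D_def
    by (auto intro!: derivative_eq_intros simp: algebra_simps)
  \<comment> \<open>The off-diagonal rates are nonnegative, so replacing the neighbours by the
    minimum \<open>m j s\<close> only lowers \<open>D\<close>. What remains is a negative
    coefficient times a negative value.\<close>
  moreover have "D > 0"
  proof -
    let ?u = "if j \<ge> 1 then lam / real j else 0"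
    have u: "?u \<le> lam" using lam by (auto simp: divide_simps)
    have "?u * m j s \<le> (if j \<ge> 1 then lam / real j * m (j - 1) s else 0)"
      using min[OF s, of "j - 1"] lam by (auto intro!: divide_right_mono mult_left_mono)
    moreover have "\<mu> * (real j + 1) * m j s \<le> \<mu> * (real j + 1) * m (j + 1) s"
      using min[OF s] mu by (intro mult_left_mono) auto
    ultimately have "(- M - R + ?u + \<mu> * (real j + 1)) * m j s \<le> D"
      unfolding D_def by (simp add: algebra_simps)
    moreover have "- M - R + ?u + \<mu> * (real j + 1) < 0"
    proof -
      have "lam / (1 + real j) \<ge> 0" using lam by simp
      then show ?thesis using u unfolding M_def R_def distrib_left by (simp add: mult.commute)
    qed
    then have "(- M - R + ?u + \<mu> * (real j + 1)) * m j s > 0"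
      using mc c by (intro mult_neg_neg) auto
    ultimately show ?thesis by linarith
  qed
  ultimately obtain d where d: "d > 0" "\<And>h. h > 0 \<Longrightarrow> s - h \<in> {0..} \<Longrightarrow> h < d \<Longrightarrow> m j (s - h) < m j s"
    using has_real_derivative_pos_inc_left by blast
  \<comment> \<open>A positive derivative gives smaller values just before \<open>s\<close>; this
    \<open>h\<close> keeps \<open>s - h\<close> within the time range and close enough to contradict
    minimality.\<close>
  define h where "h = Min {s, d / 2}"
  have h: "h > 0" "h \<le> s" "h < d" using d(1) \<open>s > 0\<close> by (auto simp: h_def min_def)
  show False using d(2)[of h] h min[of "s - h" j] s by auto
qed

section \<open>Conservation of total mass\<close>

text \<open>Transitions among the states up to \<open>n\<close> cancel. Only the exchange between
  \<open>n\<close> and \<open>n + 1\<close> is left: deaths coming in minus births going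
  out.\<close>

lemma forward_system_partial_sum_deriv:
  assumes "forward_system lam \<mu> q" "t \<ge> 0"
  shows "((\<lambda>t. \<Sum>k\<le>n. q k t) has_real_derivative
           \<mu> * (real (Suc n) * q (Suc n) t) - lam / (real n + 1) * q n t) (at t within {0..})"
proof (induction n)
  case 0
  show ?case using assms unfolding forward_system_def
    by (auto dest!: spec[where x = "0::nat"] simp: algebra_simps)
next
  case (Suc n)
  have "(q (Suc n) has_real_derivative
          (- (lam / (1 + real (Suc n)) + real (Suc n) * \<mu>) * q (Suc n) t
           + lam / real (Suc n) * q n t
           + \<mu> * (real (Suc n) + 1) * q (Suc (Suc n)) t)) (at t within {0..})"
    using assms unfolding forward_system_def by (auto dest!: spec[of _ "Suc n"])
  from DERIV_add[OF Suc this] show ?case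
    unfolding sum.atMost_Suc by (rule DERIV_cong) (simp add: algebra_simps)
qed

lemma forward_system_sums_1:
  assumes lam: "lam > 0" and mu: "\<mu> > 0" and fw: "forward_system lam \<mu> q" and "starts_at_0 q"
    and decay: "\<And>T. uniform_limit {0..T} q (\<lambda>_. 0) sequentially"
    and decay': "\<And>T. uniform_limit {0..T} (\<lambda>k t. real (Suc k) * q (Suc k) t) (\<lambda>_. 0) sequentially"
    and "t \<ge> 0"
  shows "(\<lambda>k. q k t) sums 1"
proof -
  have "(\<lambda>n. \<Sum>k\<le>n. q k t) \<longlonglongrightarrow> 1"
  proof (rule tendstoI)
    fix e :: real assume e: "e > 0"
    \<comment> \<open>The derivative bound \<open>(\<mu> + lam) * e'\<close> becomes
      \<open>e / (2 * (t + 1))\<close>, so the change over time \<open>t\<close> is below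
      \<open>e\<close>; \<open>t + 1\<close> avoids a zero denominator at
      \<open>t = 0\<close>.\<close>
    define e' where "e' = e / (2 * (t + 1) * (\<mu> + lam))"
    have e': "e' > 0" using e lam mu \<open>t \<ge> 0\<close> by (simp add: e'_def)
    show "\<forall>\<^sub>F n in sequentially. dist (\<Sum>k\<le>n. q k t) 1 < e"
      using uniform_limitD[OF decay[of t] e'] uniform_limitD[OF decay'[of t] e']
    proof eventually_elim
      case (elim n)
      let ?B = "(\<mu> + lam) * e'"
      have "norm ((\<Sum>k\<le>n. q k t) - (\<Sum>k\<le>n. q k 0)) \<le> ?B * norm (t - 0)"
      proof (rule field_differentiable_bound[of "{0..t}"])
        fix x assume x: "x \<in> {0..t}"
        show "((\<lambda>t. \<Sum>k\<le>n. q k t) has_real_derivative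
           \<mu> * (real (Suc n) * q (Suc n) x) - lam / (real n + 1) * q n x) (at x within {0..t})"
          using forward_system_partial_sum_deriv[OF fw, of x n] x
          by (auto elim: has_field_derivative_subset)
        have "\<bar>\<mu> * (real (Suc n) * q (Suc n) x)\<bar> \<le> \<mu> * e'"
          unfolding abs_mult[of \<mu>] using elim(2) x mu by (intro mult_mono) (auto simp: less_imp_le)
        moreover have "\<bar>lam / (real n + 1) * q n x\<bar> \<le> lam * e'"
          unfolding abs_mult using elim(1) x lam
          by (intro mult_mono) (auto simp: less_imp_le divide_simps)
        ultimately show "norm (\<mu> * (real (Suc n) * q (Suc n) x) - lam / (real n + 1) * q n x) \<le> ?B"
          unfolding real_norm_def distrib_right by linarith
      qed (use \<open>t \<ge> 0\<close> in auto)
      also have "?B = e / (2 * (t + 1))" using lam mu by (simp add: e'_def divide_simps)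
      also have "e / (2 * (t + 1)) * norm (t - 0) < e"
        using e \<open>t \<ge> 0\<close> by (auto simp: divide_simps algebra_simps add_nonneg_pos)
      finally show ?case
        using \<open>starts_at_0 q\<close> by (simp add: starts_at_0_def dist_real_def)
    qed
  qed
  then show ?thesis by (simp add: sums_def_le)
qed

section \<open>Uniform decay of state probabilities, and uniqueness\<close>

text \<open>The tails of the sum are continuous and decrease to \<open>0\<close>, so Dini's theorem makes them
  uniformly small.\<close>

lemma state_probabilities_uniform_limit:
  assumes cont: "\<And>k. continuous_on {0..T} (q k)" and "state_probabilities q"
  shows "uniform_limit {0..T} q (\<lambda>_. 0) sequentially"
proof (rule uniform_limitI, rule ccontr)
  fix e :: real assume e: "e > 0"
  assume "\<not> (\<forall>\<^sub>F k in sequentially. \<forall>t\<in>{0..T}. dist (q k t) 0 < e)"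
  then have "\<forall>n. \<exists>k\<ge>n. \<exists>t\<in>{0..T}. \<bar>q k t\<bar> \<ge> e"
    by (auto simp: eventually_sequentially not_less)
  then obtain \<kappa> t where kt: "\<And>n. \<kappa> n \<ge> n" "\<And>n. t n \<in> {0..T}" "\<And>n. \<bar>q (\<kappa> n) (t n)\<bar> \<ge> e"
    by metis
  have q: "0 \<le> q k x" "(\<lambda>k. q k x) sums 1" if "x \<in> {0..T}" for k x
    using assms(2) that by (auto simp: state_probabilities_def)
  \<comment> \<open>State \<open>\<kappa> i\<close> lies beyond the first \<open>n\<close> states
    and carries mass at least \<open>e\<close>, which leaves them at most
    \<open>1 - e\<close>.\<close>
  have tail: "(\<Sum>k<n. q k (t i)) \<le> 1 - e" if "n \<le> i" for n i
  proof -
    have "(\<Sum>k<n. q k (t i)) + q (\<kappa> i) (t i) \<le> (\<Sum>k<Suc (\<kappa> i). q k (t i))"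
      using kt(1)[of i] that q(1)[OF kt(2)] by (auto intro!: sum_mono2)
    also have "\<dots> \<le> (\<Sum>k. q k (t i))"
      by (rule sum_le_suminf[OF sums_summable[OF q(2)[OF kt(2)]]]) (auto intro: q(1) kt(2))
    also have "\<dots> = 1"
      using q(2)[OF kt(2)] by (simp add: sums_iff)
    finally show ?thesis using kt(3)[of i] q(1)[OF kt(2), of "\<kappa> i" i] by simp
  qed
  obtain l r where l: "l \<in> {0..T}" "strict_mono r" "(t \<circ> r) \<longlonglongrightarrow> l"
    using compact_imp_seq_compact[OF compact_Icc[of 0 T]] kt(2) unfolding seq_compact_def by metis
  \<comment> \<open>With \<open>n\<close> fixed, continuity carries the bound along the subsequence
    to \<open>l\<close>, since \<open>r i\<close> is at least \<open>i\<close>. Letting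
    \<open>n\<close> grow afterwards contradicts total mass 1 at \<open>l\<close>.\<close>
  have "(\<Sum>k<n. q k l) \<le> 1 - e" for n
  proof (rule tendsto_upperbound)
    have "continuous_on {0..T} (\<lambda>x. \<Sum>k<n. q k x)" by (intro continuous_on_sum cont)
    then show "((\<lambda>i. \<Sum>k<n. q k ((t \<circ> r) i)) \<longlongrightarrow> (\<Sum>k<n. q k l)) sequentially"
      by (rule continuous_on_tendsto_compose[OF _ l(3,1)]) (use kt(2) in auto)
    show "\<forall>\<^sub>F i in sequentially. (\<Sum>k<n. q k ((t \<circ> r) i)) \<le> 1 - e"
      using eventually_ge_at_top[of n]
    proof eventually_elim
      case (elim i)
      show ?case using tail[OF order_trans[OF elim seq_suble[OF l(2)]]] by simp
    qed
  qed simp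
  then have "1 \<le> 1 - e"
    using q(2)[OF l(1)] by (intro LIMSEQ_le_const2[of "\<lambda>n. \<Sum>k<n. q k l"]) (auto simp: sums_def)
  with e show False by simp
qed

text \<open>Decay is assumed rather than nonnegativity because it passes to \<open>q - r\<close> and
  \<open>r - q\<close>; both start at zero, so the minimum principle applies to each.\<close>

lemma forward_system_unique:
  assumes "lam > 0" "\<mu> > 0" "forward_system lam \<mu> q" "forward_system lam \<mu> r"
    and "starts_at_0 q" "starts_at_0 r"
    and dq: "\<And>T. uniform_limit {0..T} q (\<lambda>_. 0) sequentially"
    and dr: "\<And>T. uniform_limit {0..T} r (\<lambda>_. 0) sequentially"
    and "t \<ge> 0"
  shows "q k t = r k t"
proof -
  have "0 \<le> q k t - r k t"
    by (rule forward_system_nonneg[of lam \<mu> "\<lambda>k t. q k t - r k t"])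
      (use assms uniform_limit_minus[OF dq dr] in \<open>auto simp: starts_at_0_def forward_system_diff\<close>)
  moreover have "0 \<le> r k t - q k t"
    by (rule forward_system_nonneg[of lam \<mu> "\<lambda>k t. r k t - q k t"])
      (use assms uniform_limit_minus[OF dr dq] in \<open>auto simp: starts_at_0_def forward_system_diff\<close>)
  ultimately show ?thesis by simp
qed

theorem theorem8:
  fixes lam \<mu> \<alpha> :: real and S :: "nat \<Rightarrow> nat \<Rightarrow> real"
  assumes "lam > 0" and "\<mu> > 0"
    and "\<alpha> = sqrt (\<mu> / lam)"
    and "S_system \<alpha> S"
  shows "(\<forall>k. \<forall>t\<ge>0. summable (\<lambda>i. (lam * t) ^ i / fact i * S k i)) \<and>
         is_the_solution lam \<mu> (p_series lam \<alpha> S)"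
proof -
  let ?p = "p_series lam \<alpha> S"
  have \<alpha>: "\<alpha> \<noteq> 0" "\<mu> = lam * \<alpha>\<^sup>2" using assms(1-3) by auto
  note fw = p_series_forward[OF assms(1) \<alpha>(2,1) assms(4)]
  note p0 = p_series_starts_at_0[OF assms(4), of lam]
  note decay = p_series_uniform_limit[OF assms(1) \<alpha>(1) assms(4)]
  have "state_probabilities ?p"
    unfolding state_probabilities_def
  proof (intro allI impI conjI)
    fix t :: real assume "t \<ge> 0"
    then show "(\<lambda>k. ?p k t) sums 1"
      using forward_system_sums_1[OF assms(1,2) fw p0 decay] by blast
    show "0 \<le> ?p k t" for k
      by (rule forward_system_nonneg[OF assms(1,2) fw _ decay(1) \<open>t \<ge> 0\<close>])
        (use p0 in \<open>auto simp: starts_at_0_def\<close>)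
  qed
  \<comment> \<open>A competitor is known only through its state probabilities; continuity in time
    and the Dini argument supply the decay that uniqueness needs.\<close>
  moreover have "q k t = ?p k t"
    if "forward_system lam \<mu> q" "starts_at_0 q" "state_probabilities q" "t \<ge> 0" for q k t
    using forward_system_unique[OF assms(1,2) that(1) fw that(2) p0 _ decay(1) that(4)]
      state_probabilities_uniform_limit[OF forward_system_continuous[OF that(1)] that(3)] by blast
  ultimately have "is_the_solution lam \<mu> ?p"
    unfolding is_the_solution_def using fw p0 by blast
  moreover have "summable (\<lambda>i. (lam * t) ^ i / fact i * S k i)" for k t
    using S_series_summable[OF assms(4) \<alpha>(1), of k "lam * t"] by (simp add: mult.commute)
  ultimately show ?thesis by blast
qed

end
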